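(* Let $k$ be a positive integer and let $X \subset \{0,1\}^k$. If $|X|$ is a power of $2$, then there exists a positive integer $n$ such that $\{0,1\}^n$ can be partitioned into isometric copies of $X$.
   Context: For each $n$, $\{0,1\}^n$ is a metric space with the Hamming distance: $d(x,y)$ is the number of coordinates in which $x$ and $y$ differ. For $n \ge k$, a set $Y \subset \{0,1\}^n$ is an isometric copy of $X \subset \{0,1\}^k$ if there exists an isometry (distance-preserving map) $\phi : \{0,1\}^k \to \{0,1\}^n$ with $\phi(X) = Y$. *)

theory Defs
  imports "HOL-Library.FuncSet" "HOL-Library.Disjoint_Sets"
begin

(* Points of {0,1}^n are Boolean lists of length n, False standing for 0 and True for 1. *)
definition cube :: "nat \<Rightarrow> bool list set" where
  "cube n = {x. length x = n}"

(* Only meaningful for lists of equal length, which is how it is used below. *)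
definition hamming_dist :: "bool list \<Rightarrow> bool list \<Rightarrow> nat" where
  "hamming_dist x y = card {i. i < length x \<and> x ! i \<noteq> y ! i}"

definition cube_isometry :: "nat \<Rightarrow> nat \<Rightarrow> (bool list \<Rightarrow> bool list) \<Rightarrow> bool" where
  "cube_isometry k n \<phi> \<longleftrightarrow>
     \<phi> \<in> cube k \<rightarrow> cube n \<and>
     (\<forall>x\<in>cube k. \<forall>y\<in>cube k. hamming_dist (\<phi> x) (\<phi> y) = hamming_dist x y)"

(* The isometry is defined on the whole cube {0,1}^k, not just on X. *)
definition isometric_copy :: "nat \<Rightarrow> bool list set \<Rightarrow> nat \<Rightarrow> bool list set \<Rightarrow> bool" where
  "isometric_copy k X n Y \<longleftrightarrow> k \<le> n \<and> (\<exists>\<phi>. cube_isometry k n \<phi> \<and> \<phi> ` X = Y)"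

end

theory Submission
  imports Defs
begin

text \<open>
  Call a set tileable if it is a finite disjoint union of isometric copies of \<open>X\<close>.

  Signed tiling. In the quotient of the integer-valued functions on \<open>{0,1}\<^sup>n\<close> by the combinations of
  copies of \<open>X\<close>, the constant \<open>card X = 2\<^sup>m\<close> (the sum of all translates) vanishes, and, working
  modulo 2, the constant 1 equals an even function. Taking \<open>m\<close> further tensor factors thus shows that the
  constant 1 vanishes: some cube \<open>A\<close> is a signed sum of copies of \<open>X\<close>.

  From signed to genuine tilings. Let \<open>P\<close> and \<open>Q\<close> be tileable and \<open>D = P \<union> Q\<close>. Since \<open>Q\<close> and \<open>P\<close> are
  unions of neighbours in the sequence \<open>Q - P\<close>, \<open>P \<inter> Q\<close>, \<open>P - Q\<close>, powers of \<open>D\<close> decompose into the cells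
  of a large square grid of odd side length in which every domino is tileable. In \<open>D\<^sup>M \<times> A\<close>, place the
  positive tiles of the signed tiling of \<open>A\<close> above white cells and the negative ones above black cells (the corners being white).
  Above each point of \<open>A\<close> one more white than black cell is used up, and the rest of the grid can
  be covered by dominoes. So \<open>D\<^sup>M \<times> A\<close> is tileable. Adding the tiles of the signed tiling one at a time, this yields
  by induction tileable products of copies of \<open>A\<close> and of a union of tiles; once the union is all of \<open>A\<close>,
  the product is a cube.
\<close>

section \<open>Tilings and dominoes\<close>

text \<open>The predicate \<open>T\<close> is a parameter because the same notion serves dominoes in
  a grid and copies of \<open>X\<close> in cubes. The tiles carry no index set, so tilings can be
  built and pulled back by rule induction.\<close>

inductive tileable :: "('a set \<Rightarrow> bool) \<Rightarrow> 'a set \<Rightarrow> bool" for T where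
  tileable_empty: "tileable T {}"
| tileable_insert: "T F \<Longrightarrow> tileable T S \<Longrightarrow> F \<inter> S = {} \<Longrightarrow> tileable T (F \<union> S)"

lemma tileable_tile: "T F \<Longrightarrow> tileable T F"
  using tileable_insert[of T F "{}"] tileable_empty[of T] by simp

lemma tileable_Un:
  assumes "tileable T A" "tileable T B" "A \<inter> B = {}"
  shows "tileable T (A \<union> B)"
  using assms
proof (induction A)
  case (tileable_insert F S)
  have "F \<inter> (S \<union> B) = {}" "tileable T (S \<union> B)"
    using tileable_insert by auto
  then show ?case
    using tileable.tileable_insert[of T F "S \<union> B"] tileable_insert(1) by (simp add: Un_assoc)
qed simp

lemma tileable_UN:
  assumes "finite I" "\<And>i. i \<in> I \<Longrightarrow> tileable T (A i)" "disjoint_family_on A I"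
  shows "tileable T (\<Union>i\<in>I. A i)"
  using assms
proof (induction I)
  case (insert i I)
  have "A i \<inter> A j = {}" if "j \<in> I" for j
    using that insert.hyps by (intro disjoint_family_onD[OF insert.prems(2)]) auto
  then have "A i \<inter> (\<Union>i\<in>I. A i) = {}"
    by auto
  moreover have "tileable T (\<Union>i\<in>I. A i)"
    using insert.prems by (intro insert.IH) (auto simp: disjoint_family_on_def)
  ultimately show ?case
    using tileable_Un[of T "A i" "\<Union>i\<in>I. A i"] insert.prems by simp
qed (simp add: tileable_empty)

text \<open>Every tile of a tiling lies in the tiled set. This is needed because only dominoes
  inside the square pull back to tileable sets.\<close>

lemma tileable_restrict:
  assumes "tileable T R" "R \<subseteq> S"
  shows "tileable (\<lambda>F. T F \<and> F \<subseteq> S) R"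
  using assms by induction (auto intro: tileable.intros)

text \<open>Preimages preserve disjoint unions, so a domino tiling of a grid lifts along a labelling
  \<open>g\<close> of points by grid cells.\<close>

lemma tileable_vimage:
  assumes "tileable T' R" "\<And>F. T' F \<Longrightarrow> tileable T {u \<in> D. g u \<in> F}"
  shows "tileable T {u \<in> D. g u \<in> R}"
  using assms(1)
proof induction
  case (tileable_insert F S)
  have "{u \<in> D. g u \<in> F \<union> S} = {u \<in> D. g u \<in> F} \<union> {u \<in> D. g u \<in> S}"
    by auto
  moreover have "{u \<in> D. g u \<in> F} \<inter> {u \<in> D. g u \<in> S} = {}"
    using tileable_insert by auto
  ultimately show ?case
    using tileable_Un[OF assms(2)[OF tileable_insert(1)] tileable_insert.IH] by simp
qed (simp add: tileable_empty)

section \<open>Domino tilings of grids with removed cells\<close>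

definition domino :: "(nat \<times> nat) set \<Rightarrow> bool" where
  "domino F \<longleftrightarrow> (\<exists>c r. F = {(c, r), (Suc c, r)} \<or> F = {(c, r), (c, Suc r)})"

lemma tileable_row: "tileable domino ({c..<c + 2 * n} \<times> {r})"
proof (induction n)
  case (Suc n)
  have "domino {(c + 2 * n, r), (Suc (c + 2 * n), r)}"
    by (auto simp: domino_def)
  moreover have "{c..<c + 2 * Suc n} \<times> {r} = {(c + 2 * n, r), (Suc (c + 2 * n), r)} \<union> {c..<c + 2 * n} \<times> {r}"
    by auto
  moreover have "{(c + 2 * n, r), (Suc (c + 2 * n), r)} \<inter> {c..<c + 2 * n} \<times> {r} = {}"
    by auto
  ultimately show ?case
    using tileable_insert[OF _ Suc] by metis
qed (simp add: tileable_empty)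

lemma tileable_column: "tileable domino ({c} \<times> {r..<r + 2 * n})"
proof (induction n)
  case (Suc n)
  have "domino {(c, r + 2 * n), (c, Suc (r + 2 * n))}"
    by (auto simp: domino_def)
  moreover have "{c} \<times> {r..<r + 2 * Suc n} = {(c, r + 2 * n), (c, Suc (r + 2 * n))} \<union> {c} \<times> {r..<r + 2 * n}"
    by auto
  moreover have "{(c, r + 2 * n), (c, Suc (r + 2 * n))} \<inter> {c} \<times> {r..<r + 2 * n} = {}"
    by auto
  ultimately show ?case
    using tileable_insert[OF _ Suc] by metis
qed (simp add: tileable_empty)

lemma tileable_rectangle: "tileable domino ({c..<c + 2 * n} \<times> {r..<r + m})"
proof -
  have "tileable domino (\<Union>i\<in>{r..<r + m}. {c..<c + 2 * n} \<times> {i})"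
    by (intro tileable_UN tileable_row) (auto simp: disjoint_family_on_def)
  moreover have "(\<Union>i\<in>{r..<r + m}. {c..<c + 2 * n} \<times> {i}) = {c..<c + 2 * n} \<times> {r..<r + m}"
    by auto
  ultimately show ?thesis by simp
qed

text \<open>Wire \<open>i\<close> consists of the columns \<open>2i\<close> and \<open>2i + 1\<close>. The sign of a token is the chessboard colour
  of the cell it removes.\<close>

definition token :: "(nat \<Rightarrow> int) \<Rightarrow> nat \<Rightarrow> nat \<Rightarrow> (nat \<times> nat) set" where
  "token \<sigma> r i = (if \<sigma> i = 1 then {(2 * i, r)} else if \<sigma> i = -1 then {(2 * i + 1, r)} else {})"

lemma token_subset: "token \<sigma> r i \<subseteq> {2 * i, 2 * i + 1} \<times> {r}"
  by (auto simp: token_def)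

lemma disjoint_token: "disjoint_family_on (token \<sigma> r) I"
  by (auto simp: disjoint_family_on_def token_def split: if_splits)

text \<open>If a cell is missing, one vertical domino stands beside the hole and another above it,
  reaching into row \<open>r + 2\<close>. The hole thereby moves up two rows and keeps its column,
  hence its colour.\<close>

lemma transport_token:
  assumes "\<sigma> i \<in> {-1, 0, 1}"
  shows "tileable domino (({2 * i, 2 * i + 1} \<times> {r, Suc r} - token \<sigma> r i) \<union> token \<sigma> (r + 2) i)"
proof -
  have two: "tileable domino (A \<union> B)" if "domino A" "domino B" "A \<inter> B = {}" for A B
    using that by (intro tileable_Un tileable_tile)
  consider "\<sigma> i = 0" | "\<sigma> i = 1" | "\<sigma> i = -1"
    using assms by auto
  then show ?thesis
  proof cases
    case 1
    have "tileable domino ({(2*i, r), (Suc (2*i), r)} \<union> {(2*i, Suc r), (Suc (2*i), Suc r)})"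
      by (rule two) (auto simp: domino_def)
    also have "{(2*i, r), (Suc (2*i), r)} \<union> {(2*i, Suc r), (Suc (2*i), Suc r)}
      = ({2 * i, 2 * i + 1} \<times> {r, Suc r} - token \<sigma> r i) \<union> token \<sigma> (r + 2) i"
      using 1 by (auto simp: token_def)
    finally show ?thesis .
  next
    case 2
    have "tileable domino ({(Suc (2*i), r), (Suc (2*i), Suc r)} \<union> {(2*i, Suc r), (2*i, Suc (Suc r))})"
      by (rule two) (auto simp: domino_def)
    also have "{(Suc (2*i), r), (Suc (2*i), Suc r)} \<union> {(2*i, Suc r), (2*i, Suc (Suc r))}
      = ({2 * i, 2 * i + 1} \<times> {r, Suc r} - token \<sigma> r i) \<union> token \<sigma> (r + 2) i"
      using 2 by (auto simp: token_def)
    finally show ?thesis .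
  next
    case 3
    have "tileable domino ({(2*i, r), (2*i, Suc r)} \<union> {(Suc (2*i), Suc r), (Suc (2*i), Suc (Suc r))})"
      by (rule two) (auto simp: domino_def)
    also have "{(2*i, r), (2*i, Suc r)} \<union> {(Suc (2*i), Suc r), (Suc (2*i), Suc (Suc r))}
      = ({2 * i, 2 * i + 1} \<times> {r, Suc r} - token \<sigma> r i) \<union> token \<sigma> (r + 2) i"
      using 3 by (auto simp: token_def)
    finally show ?thesis .
  qed
qed

text \<open>The two holes have opposite colours. If they are the outermost cells of row
  \<open>r\<close>, both rows leave stretches of even length. Otherwise vertical dominoes fill the
  two outer columns, and the stretches left between them are even.\<close>

lemma annihilate_tokens:
  assumes "i < j" "\<sigma> i \<in> {-1, 1}" "\<sigma> j = - \<sigma> i"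
  shows "tileable domino ({2 * i..<2 * j + 2} \<times> {r, Suc r} - token \<sigma> r i - token \<sigma> r j)"
proof -
  consider "\<sigma> i = 1" "\<sigma> j = -1" | "\<sigma> i = -1" "\<sigma> j = 1"
    using assms by auto
  then show ?thesis
  proof cases
    case 1
    have "tileable domino ({2 * i + 1..<2 * i + 1 + 2 * (j - i)} \<times> {r}
        \<union> {2 * i..<2 * i + 2 * (j + 1 - i)} \<times> {Suc r})"
      by (intro tileable_Un tileable_row) auto
    also have "{2 * i + 1..<2 * i + 1 + 2 * (j - i)} \<times> {r} \<union> {2 * i..<2 * i + 2 * (j + 1 - i)} \<times> {Suc r}
      = {2 * i..<2 * j + 2} \<times> {r, Suc r} - token \<sigma> r i - token \<sigma> r j"
      using 1 \<open>i < j\<close> by (auto simp: token_def)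
    finally show ?thesis .
  next
    case 2
    have "tileable domino (({2 * i} \<times> {r..<r + 2 * 1} \<union> {2 * j + 1} \<times> {r..<r + 2 * 1})
        \<union> ({2 * i + 2..<2 * i + 2 + 2 * (j - i - 1)} \<times> {r}
        \<union> {2 * i + 1..<2 * i + 1 + 2 * (j - i)} \<times> {Suc r}))"
      using \<open>i < j\<close> by (intro tileable_Un tileable_row tileable_column) auto
    also have "({2 * i} \<times> {r..<r + 2 * 1} \<union> {2 * j + 1} \<times> {r..<r + 2 * 1})
        \<union> ({2 * i + 2..<2 * i + 2 + 2 * (j - i - 1)} \<times> {r}
        \<union> {2 * i + 1..<2 * i + 1 + 2 * (j - i)} \<times> {Suc r})
      = {2 * i..<2 * j + 2} \<times> {r, Suc r} - token \<sigma> r i - token \<sigma> r j"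
      using 2 \<open>i < j\<close> by (auto simp: token_def)
    finally show ?thesis .
  qed
qed

text \<open>A vanishing sum with a nonzero term has terms of both signs. In a pair of opposite terms
  at least distance, a nonzero term in between would be opposite to one of the two ends and give a
  closer pair.\<close>

lemma adjacent_opposite_signs:
  fixes \<sigma> :: "nat \<Rightarrow> int"
  assumes "(\<Sum>i<L. \<sigma> i) = 0" "\<And>i. \<sigma> i \<in> {-1, 0, 1}" "k < L" "\<sigma> k \<noteq> 0"
  obtains i j where "i < j" "j < L" "\<sigma> i \<in> {-1, 1}" "\<sigma> j = - \<sigma> i" "\<And>l. i < l \<Longrightarrow> l < j \<Longrightarrow> \<sigma> l = 0"
proof -
  let ?P = "\<lambda>d. \<exists>i. i + d < L \<and> \<sigma> i \<noteq> 0 \<and> \<sigma> (i + d) = - \<sigma> i"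
  have "\<exists>d. ?P d"
  proof -
    have "\<exists>l<L. \<sigma> l = - \<sigma> k"
    proof (rule ccontr)
      assume no: "\<not> ?thesis"
      have "\<sigma> k * \<sigma> l \<ge> 0" if "l < L" for l
        using no that assms(2)[of k] assms(2)[of l] by auto
      then have "(\<Sum>l<L. \<sigma> k * \<sigma> l) > 0"
        using assms(3,4) by (intro sum_pos2[of _ k]) (auto simp: zero_less_mult_iff)
      then show False
        using assms(1) by (simp flip: sum_distrib_left)
    qed
    then obtain l where l: "l < L" "\<sigma> l = - \<sigma> k" by blast
    then have "?P (if k < l then l - k else k - l)"
      using assms(3,4) by (cases "k < l") (auto intro!: exI[of _ "min k l"])
    then show ?thesis ..
  qed
  then have *: "?P (LEAST d. ?P d)" by (rule LeastI_ex)
  define d where "d = (LEAST d. ?P d)"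
  obtain i where i: "i + d < L" "\<sigma> i \<noteq> 0" "\<sigma> (i + d) = - \<sigma> i"
    using * unfolding d_def by blast
  have "d \<noteq> 0" using i by (intro notI) simp
  have zero: "\<sigma> l = 0" if "i < l" "l < i + d" for l
  proof (rule ccontr)
    assume "\<sigma> l \<noteq> 0"
    then consider "\<sigma> l = - \<sigma> i" | "\<sigma> l = \<sigma> i"
      using assms(2)[of l] assms(2)[of i] i(2) by auto
    then show False
    proof cases
      case 1
      then have "?P (l - i)" using i that by (intro exI[of _ i]) auto
      then show ?thesis using Least_le[of ?P] that unfolding d_def by fastforce
    next
      case 2
      then have "?P (i + d - l)" using i that by (intro exI[of _ l]) auto
      then show ?thesis using Least_le[of ?P] that unfolding d_def by fastforce
    qed
  qed
  show ?thesis
    by (rule that[of i "i + d"]) (use i zero \<open>d \<noteq> 0\<close> assms(2)[of i] in auto)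
qed

text \<open>Two rows suffice to cancel two opposite tokens that are adjacent among the remaining ones,
  while all other tokens move up along their wires.\<close>

lemma tileable_strip_minus_tokens:
  assumes "(\<Sum>i<L. \<sigma> i) = 0" "\<And>i. \<sigma> i \<in> {-1, 0, 1}" "card {i. i < L \<and> \<sigma> i \<noteq> 0} \<le> 2 * h"
  shows "tileable domino ({..<2 * L} \<times> {r..<r + 2 * h} - (\<Union>i<L. token \<sigma> r i))"
  using assms
proof (induction h arbitrary: \<sigma> r)
  case 0
  then show ?case by (simp add: tileable_empty)
next
  case (Suc h)
  show ?case
  proof (cases "\<exists>k<L. \<sigma> k \<noteq> 0")
    case False
    then have "(\<Union>i<L. token \<sigma> r i) = {}"
      by (auto simp: token_def)
    then show ?thesis
      using tileable_rectangle[of 0 L r "2 * Suc h"] by (simp add: lessThan_atLeast0)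
  next
    case True
    then obtain k where "k < L" "\<sigma> k \<noteq> 0" by blast
    then obtain i j where ij: "i < j" "j < L" "\<sigma> i \<in> {-1, 1}" "\<sigma> j = - \<sigma> i"
      and zero: "\<And>l. i < l \<Longrightarrow> l < j \<Longrightarrow> \<sigma> l = 0"
      using adjacent_opposite_signs[OF Suc.prems(1,2)] by metis
    define \<tau> where "\<tau> = \<sigma>(i := 0, j := 0)"
    have \<tau>: "\<tau> l \<in> {-1, 0, 1}" for l
      using Suc.prems(2) by (auto simp: \<tau>_def)
    have "(\<Sum>l<L. \<sigma> l) = \<sigma> i + \<sigma> j + (\<Sum>l\<in>{..<L} - {i, j}. \<sigma> l)"
      using ij sum.subset_diff[of "{i, j}" "{..<L}" \<sigma>] by auto
    moreover have "(\<Sum>l<L. \<tau> l) = (\<Sum>l\<in>{..<L} - {i, j}. \<sigma> l)"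
      by (intro sum.mono_neutral_cong_right) (auto simp: \<tau>_def)
    ultimately have sum: "(\<Sum>l<L. \<tau> l) = 0"
      using Suc.prems(1) ij by simp
    have "{l. l < L \<and> \<sigma> l \<noteq> 0} = {i, j} \<union> {l. l < L \<and> \<tau> l \<noteq> 0}"
      using ij by (auto simp: \<tau>_def)
    moreover have "{i, j} \<inter> {l. l < L \<and> \<tau> l \<noteq> 0} = {}"
      by (auto simp: \<tau>_def)
    ultimately have "card {l. l < L \<and> \<sigma> l \<noteq> 0} = 2 + card {l. l < L \<and> \<tau> l \<noteq> 0}"
      using ij by (simp add: card_Un_disjoint)
    then have card: "card {l. l < L \<and> \<tau> l \<noteq> 0} \<le> 2 * h"
      using Suc.prems(3) by simp
    \<comment> \<open>The wires outside \<open>{i..j}\<close> transport their tokens, and the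
      dominoes in \<open>?B l\<close> that stick out into row \<open>r + 2\<close> fill exactly the
      holes of \<open>?rest\<close>. The block \<open>?mid\<close> absorbs the cancelled
      pair.\<close>
    let ?rest = "{..<2 * L} \<times> {r + 2..<r + 2 + 2 * h} - (\<Union>l<L. token \<tau> (r + 2) l)"
    let ?mid = "{2 * i..<2 * j + 2} \<times> {r, Suc r} - token \<sigma> r i - token \<sigma> r j"
    let ?B = "\<lambda>l. ({2 * l, 2 * l + 1} \<times> {r, Suc r} - token \<sigma> r l) \<union> token \<sigma> (r + 2) l"
    let ?I = "{..<L} - {i..j}"
    have rest: "tileable domino ?rest"
      using Suc.IH[OF sum \<tau> card] .
    have mid: "tileable domino ?mid"
      using annihilate_tokens ij by blast
    have B: "tileable domino (\<Union>l\<in>?I. ?B l)"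
    proof (intro tileable_UN transport_token Suc.prems(2))
      show "disjoint_family_on ?B ?I"
        by (auto simp: disjoint_family_on_def token_def split: if_splits)
    qed simp
    have tok: "(\<Union>l<L. token \<tau> (r + 2) l) = (\<Union>l\<in>?I. token \<sigma> (r + 2) l)"
    proof -
      have "token \<tau> (r + 2) l = (if l \<in> {i..j} then {} else token \<sigma> (r + 2) l)" if "l < L" for l
        using zero[of l] ij(1) by (auto simp: \<tau>_def token_def)
      then show ?thesis by (auto split: if_splits)
    qed
    \<comment> \<open>For \<open>h = 0\<close> the upper strip is empty, so protruding cells would
      not fit; the cardinality bound then says that no token is left.\<close>
    have sub: "(\<Union>l<L. token \<tau> (r + 2) l) \<subseteq> {..<2 * L} \<times> {r + 2..<r + 2 + 2 * h}"
    proof (cases "h = 0")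
      case True
      then have "\<tau> l = 0" if "l < L" for l using card that by auto
      then show ?thesis by (auto simp: token_def)
    qed (auto simp: token_def split: if_splits)
    have tok2: "(\<Union>l<L. token \<sigma> r l) = token \<sigma> r i \<union> token \<sigma> r j \<union> (\<Union>l\<in>?I. token \<sigma> r l)"
    proof -
      have "token \<sigma> r l = {}" if "i < l" "l < j" for l
        using zero that by (simp add: token_def)
      then have "(\<Union>l\<in>{i<..<j}. token \<sigma> r l) = {}"
        by auto
      moreover have "{..<L} = {i, j} \<union> {i<..<j} \<union> ?I"
        using ij by auto
      then have "(\<Union>l<L. token \<sigma> r l) = (\<Union>l\<in>{i, j} \<union> {i<..<j} \<union> ?I. token \<sigma> r l)"
        by (rule arg_cong)
      ultimately show ?thesis
        by (simp only: UN_Un UN_insert UN_empty Un_empty_right)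
    qed
    have cells: "{..<2 * L} = {2 * i..<2 * j + 2} \<union> (\<Union>l\<in>?I. {2 * l, 2 * l + 1})"
    proof (intro equalityI subsetI)
      fix x assume x: "x \<in> {..<2 * L}"
      have "x = 2 * (x div 2) \<or> x = 2 * (x div 2) + 1" by presburger
      moreover have "x div 2 < L" using x by auto
      ultimately show "x \<in> {2 * i..<2 * j + 2} \<union> (\<Union>l\<in>?I. {2 * l, 2 * l + 1})"
        by (cases "x div 2 \<in> {i..j}") auto
    qed (use ij in auto)
    have outside: "token \<sigma> r l \<inter> {2 * i..<2 * j + 2} \<times> {r, Suc r} = {}" if "l \<in> ?I" for l
      using that token_subset[of \<sigma> r l] by auto
    have inside: "(token \<sigma> r i \<union> token \<sigma> r j) \<inter> {2 * l, 2 * l + 1} \<times> {r, Suc r} = {}" if "l \<in> ?I" for l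
      using that ij token_subset[of \<sigma> r i] token_subset[of \<sigma> r j] by auto
    have other: "token \<sigma> r l' \<inter> {2 * l, 2 * l + 1} \<times> {r, Suc r} = {}" if "l \<noteq> l'" for l l'
      using that token_subset[of \<sigma> r l'] by auto
    have rows: "{..<2 * L} \<times> {r, Suc r} - (\<Union>l<L. token \<sigma> r l)
      = ?mid \<union> (\<Union>l\<in>?I. {2 * l, 2 * l + 1} \<times> {r, Suc r} - token \<sigma> r l)"
      (is "?lhs = ?rhs")
    proof -
      have "?lhs = ({2 * i..<2 * j + 2} \<times> {r, Suc r} - (\<Union>l<L. token \<sigma> r l))
         \<union> (\<Union>l\<in>?I. {2 * l, 2 * l + 1} \<times> {r, Suc r} - (\<Union>l<L. token \<sigma> r l))"
        unfolding cells by blast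
      also have "{2 * i..<2 * j + 2} \<times> {r, Suc r} - (\<Union>l<L. token \<sigma> r l) = ?mid"
        unfolding tok2 using outside by blast
      also have "(\<Union>l\<in>?I. {2 * l, 2 * l + 1} \<times> {r, Suc r} - (\<Union>l<L. token \<sigma> r l))
        = (\<Union>l\<in>?I. {2 * l, 2 * l + 1} \<times> {r, Suc r} - token \<sigma> r l)"
      proof (rule SUP_cong[OF refl])
        fix l assume "l \<in> ?I"
        have "(\<Union>l<L. token \<sigma> r l) = token \<sigma> r l \<union> (\<Union>l'\<in>{..<L} - {l}. token \<sigma> r l')"
          using \<open>l \<in> ?I\<close> by blast
        moreover have "(\<Union>l'\<in>{..<L} - {l}. token \<sigma> r l') \<inter> {2 * l, 2 * l + 1} \<times> {r, Suc r} = {}"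
          using other by (simp add: Int_UN_distrib2 del: One_nat_def)
        ultimately show "{2 * l, 2 * l + 1} \<times> {r, Suc r} - (\<Union>l<L. token \<sigma> r l)
          = {2 * l, 2 * l + 1} \<times> {r, Suc r} - token \<sigma> r l"
          by blast
      qed
      finally show ?thesis .
    qed
    have split: "{r..<r + 2 * Suc h} = {r, Suc r} \<union> {r + 2..<r + 2 + 2 * h}"
      by auto
    have "{..<2 * L} \<times> {r..<r + 2 * Suc h} - (\<Union>l<L. token \<sigma> r l)
      = ({..<2 * L} \<times> {r, Suc r} - (\<Union>l<L. token \<sigma> r l)) \<union> {..<2 * L} \<times> {r + 2..<r + 2 + 2 * h}"
      unfolding split using token_subset[of \<sigma> r] by fastforce
    also have "\<dots> = (?mid \<union> (\<Union>l\<in>?I. ?B l)) \<union> ?rest"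
    proof -
      have "(\<Union>l\<in>?I. ?B l) = (\<Union>l\<in>?I. {2 * l, 2 * l + 1} \<times> {r, Suc r} - token \<sigma> r l)
        \<union> (\<Union>l<L. token \<tau> (r + 2) l)"
        unfolding tok by (rule UN_Un_distrib)
      moreover have "(\<Union>l<L. token \<tau> (r + 2) l) \<union> ?rest = {..<2 * L} \<times> {r + 2..<r + 2 + 2 * h}"
        using sub by (rule Diff_partition)
      ultimately show ?thesis
        unfolding rows by (simp only: Un_assoc)
    qed
    finally have eq: "{..<2 * L} \<times> {r..<r + 2 * Suc h} - (\<Union>l<L. token \<sigma> r l) = \<dots>" .
    have "?mid \<inter> (\<Union>l\<in>?I. ?B l) = {}"
    proof -
      have "{2 * i..<2 * j + 2} \<times> {r, Suc r} \<inter> ?B l = {}" if "l \<in> ?I" for l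
        using that token_subset[of \<sigma> "r + 2" l] by auto
      then show ?thesis by blast
    qed
    moreover have "(?mid \<union> (\<Union>l\<in>?I. ?B l)) \<inter> ?rest = {}"
      using tok by auto
    ultimately show ?thesis
      unfolding eq by (intro tileable_Un mid B rest)
  qed
qed

text \<open>The surplus token is balanced by a negative one on the extra wire \<open>L\<close>, whose cell is covered by the
  domino reaching into the last column.\<close>

lemma tileable_square_minus_tokens:
  assumes "(\<Sum>i<L. \<sigma> i) = 1" "\<And>i. \<sigma> i \<in> {-1, 0, 1}"
  shows "tileable domino ({..2 * Suc L} \<times> {..2 * Suc L} - (\<Union>i<L. token \<sigma> 0 i))"
proof -
  define \<tau> where "\<tau> = \<sigma>(L := -1)"
  define U where "U = (\<Union>i<L. token \<sigma> 0 i)"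
  have tok: "(\<Union>i<Suc L. token \<tau> 0 i) = insert (2 * L + 1, 0) U"
    by (auto simp: lessThan_Suc \<tau>_def token_def U_def)
  have U: "c < 2 * L" "r = 0" if "(c, r) \<in> U" for c r
    using that token_subset[of \<sigma> 0] unfolding U_def by fastforce+
  have "tileable domino ({..<2 * Suc L} \<times> {0..<0 + 2 * Suc L} - (\<Union>i<Suc L. token \<tau> 0 i))"
  proof (rule tileable_strip_minus_tokens)
    have "(\<Sum>i<L. \<tau> i) = (\<Sum>i<L. \<sigma> i)"
      by (intro sum.cong) (auto simp: \<tau>_def)
    then show "(\<Sum>i<Suc L. \<tau> i) = 0"
      using assms(1) by (simp add: \<tau>_def)
    show "\<tau> i \<in> {-1, 0, 1}" for i
      using assms(2) by (auto simp: \<tau>_def)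
    \<comment> \<open>One token per wire is a crude bound, but the strip has twice as many rows as
      wires.\<close>
    have "card {i. i < Suc L \<and> \<tau> i \<noteq> 0} \<le> card {..<Suc L}"
      by (intro card_mono) auto
    then show "card {i. i < Suc L \<and> \<tau> i \<noteq> 0} \<le> 2 * Suc L"
      by simp
  qed
  note strip = this[unfolded tok]
  have corner: "domino {(2 * L + 1, 0), (Suc (2 * L + 1), 0)}"
    by (auto simp: domino_def)
  \<comment> \<open>The square is the strip with one more column and one more row. The corner domino
    fills the hole of the extra wire and the lowest cell of the new column; what remains of the
    border consists of two lines of even length.\<close>
  have "tileable domino (({..<2 * Suc L} \<times> {0..<0 + 2 * Suc L} - insert (2 * L + 1, 0) U) \<union>
      ({(2 * L + 1, 0), (Suc (2 * L + 1), 0)} \<union> ({2 * Suc L} \<times> {1..<1 + 2 * Suc L} \<union>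
      {0..<0 + 2 * Suc L} \<times> {2 * Suc L})))"
    by (intro tileable_Un tileable_row tileable_column tileable_tile[where T = domino, OF corner] strip)
      auto
  also have "(({..<2 * Suc L} \<times> {0..<0 + 2 * Suc L} - insert (2 * L + 1, 0) U) \<union>
      ({(2 * L + 1, 0), (Suc (2 * L + 1), 0)} \<union> ({2 * Suc L} \<times> {1..<1 + 2 * Suc L} \<union>
      {0..<0 + 2 * Suc L} \<times> {2 * Suc L}))) = {..2 * Suc L} \<times> {..2 * Suc L} - U"
    by (auto dest: U)
  finally show ?thesis unfolding U_def .
qed

section \<open>Tilings of sets of lists\<close>

text \<open>This plays the role of the Cartesian product: if the words in the first factor all have
  the same length, every word of the result splits uniquely.\<close>

definition conc :: "'a list set \<Rightarrow> 'a list set \<Rightarrow> 'a list set" (infixr "\<odot>" 70) where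
  "S \<odot> T = (\<lambda>(s, t). s @ t) ` (S \<times> T)"

lemma conc_empty [simp]: "{} \<odot> S = {}" "S \<odot> {} = {}"
  by (auto simp: conc_def)

lemma conc_Nil [simp]: "{[]} \<odot> S = S" "S \<odot> {[]} = S"
  by (auto simp: conc_def image_def)

lemma conc_assoc: "(S \<odot> T) \<odot> U = S \<odot> (T \<odot> U)"
proof (intro equalityI subsetI)
  show "w \<in> S \<odot> (T \<odot> U)" if "w \<in> (S \<odot> T) \<odot> U" for w
    using that by (clarsimp simp: conc_def image_iff)
  show "w \<in> (S \<odot> T) \<odot> U" if "w \<in> S \<odot> (T \<odot> U)" for w
    using that by (clarsimp simp: conc_def image_iff)
qed

lemma mem_conc:
  assumes "S \<subseteq> cube n"
  shows "w \<in> S \<odot> T \<longleftrightarrow> take n w \<in> S \<and> drop n w \<in> T"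
proof
  assume "w \<in> S \<odot> T"
  then obtain s t where st: "s \<in> S" "t \<in> T" "w = s @ t"
    by (auto simp: conc_def)
  moreover have "length s = n"
    using assms st by (auto simp: cube_def)
  ultimately show "take n w \<in> S \<and> drop n w \<in> T" by simp
next
  assume "take n w \<in> S \<and> drop n w \<in> T"
  then show "w \<in> S \<odot> T"
    unfolding conc_def by (intro image_eqI[where x = "(take n w, drop n w)"]) auto
qed

lemma conc_cube_subset: "S \<subseteq> cube n \<Longrightarrow> T \<subseteq> cube m \<Longrightarrow> S \<odot> T \<subseteq> cube (n + m)"
  by (auto simp: conc_def cube_def subset_iff)

lemma conc_cube_cube: "cube n \<odot> cube m = cube (n + m)"
  by (auto simp: mem_conc[OF order_refl]) (auto simp: cube_def)

lemma finite_cube [simp]: "finite (cube n)"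
  using finite_lists_length_eq[of "UNIV :: bool set" n] by (simp add: cube_def)

text \<open>The empty words bring both decompositions into the shape \<open>u @ s @ v\<close> of the
  maps that preserve tiles.\<close>

lemma conc_eq_UN: "S \<odot> T = (\<Union>s\<in>S. (\<lambda>t. s @ t @ []) ` T)" "S \<odot> T = (\<Union>t\<in>T. (\<lambda>s. [] @ s @ t) ` S)"
  by (auto simp: conc_def)

primrec conc_power :: "'a list set \<Rightarrow> nat \<Rightarrow> 'a list set" where
  "conc_power D 0 = {[]}"
| "conc_power D (Suc m) = D \<odot> conc_power D m"

lemma conc_power_subset: "D \<subseteq> cube n \<Longrightarrow> conc_power D m \<subseteq> cube (m * n)"
proof (induction m)
  case 0
  then show ?case by (simp add: cube_def)
next
  case (Suc m)
  then show ?case using conc_cube_subset[of D n "conc_power D m" "m * n"] by simp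
qed

lemma conc_power_add: "conc_power D (a + b) = conc_power D a \<odot> conc_power D b"
  by (induction a) (auto simp: conc_assoc)

text \<open>Fixing additional coordinates before and after a tile yields a tile in a larger cube.
  The predicate has no dimension argument, so tiles of all dimensions belong to one family.\<close>

locale tile_family =
  fixes T :: "bool list set \<Rightarrow> bool"
  assumes frame: "T F \<Longrightarrow> T ((\<lambda>s. u @ s @ v) ` F)"
begin

lemma tileable_frame: "tileable T S \<Longrightarrow> tileable T ((\<lambda>s. u @ s @ v) ` S)"
proof (induction S rule: tileable.induct)
  case (tileable_insert F S)
  have "(\<lambda>s. u @ s @ v) ` F \<inter> (\<lambda>s. u @ s @ v) ` S = {}"
    using tileable_insert by (auto simp: image_iff)
  then show ?case
    using tileable.tileable_insert[of T "(\<lambda>s. u @ s @ v) ` F" "(\<lambda>s. u @ s @ v) ` S"]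
      tileable_insert frame by (simp add: image_Un)
qed (simp add: tileable_empty)

text \<open>One tileable factor suffices: the product is a union of framed copies of
  \<open>S\<close>, one for each prefix, and these are disjoint because prefixes of equal length
  differ.\<close>

lemma tileable_conc_left:
  assumes "tileable T S" "A \<subseteq> cube n"
  shows "tileable T (A \<odot> S)"
  unfolding conc_eq_UN(1)
proof (intro tileable_UN tileable_frame assms)
  show "finite A" using finite_subset[OF assms(2)] by simp
  show "disjoint_family_on (\<lambda>s. (\<lambda>t. s @ t @ []) ` S) A"
  proof (unfold disjoint_family_on_def, intro ballI impI)
    fix s s' assume "s \<in> A" "s' \<in> A" "s \<noteq> s'"
    moreover from this have "length s = length s'"
      using assms(2) by (auto simp: cube_def)
    ultimately show "(\<lambda>t. s @ t @ []) ` S \<inter> (\<lambda>t. s' @ t @ []) ` S = {}"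
      by auto
  qed
qed

lemma tileable_conc_right:
  assumes "tileable T S" "S \<subseteq> cube n" "finite B"
  shows "tileable T (S \<odot> B)"
  unfolding conc_eq_UN(2)
proof (intro tileable_UN tileable_frame assms)
  show "disjoint_family_on (\<lambda>t. (\<lambda>s. [] @ s @ t) ` S) B"
  proof (unfold disjoint_family_on_def, intro ballI impI)
    fix t t' :: "bool list" assume "t \<noteq> t'"
    have "s @ t \<noteq> s' @ t'" if "s \<in> S" "s' \<in> S" for s s'
    proof -
      have "length s = length s'"
        using assms(2) that by (auto simp: cube_def)
      then show ?thesis using \<open>t \<noteq> t'\<close> by simp
    qed
    then show "(\<lambda>s. [] @ s @ t) ` S \<inter> (\<lambda>s. [] @ s @ t') ` S = {}"
      by auto
  qed
qed

text \<open>The three cells of \<open>P \<union> Q\<close> form a path; its powers are traversed boustrophedonically.\<close>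

lemma ex_path_labelling:
  assumes "tileable T P" "tileable T Q" "P \<subseteq> cube n" "Q \<subseteq> cube n"
  shows "\<exists>h. (\<forall>w\<in>conc_power (P \<union> Q) m. h w < (3::nat) ^ m) \<and>
    (\<forall>i. Suc i < 3 ^ m \<longrightarrow> tileable T {w \<in> conc_power (P \<union> Q) m. h w \<in> {i, Suc i}})"
proof (induction m)
  case 0
  show ?case by (intro exI[of _ "\<lambda>_. 0"]) auto
next
  case (Suc m)
  define D where "D = P \<union> Q"
  define E where "E = conc_power D m"
  define N :: nat where "N = 3 ^ m"
  obtain h where h: "\<And>w. w \<in> E \<Longrightarrow> h w < N"
    and adj: "\<And>i. Suc i < N \<Longrightarrow> tileable T {w \<in> E. h w \<in> {i, Suc i}}"
    using Suc unfolding D_def E_def N_def by blast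
  have "N > 0" by (simp add: N_def)
  have D: "D \<subseteq> cube n" using assms by (simp add: D_def)
  have E: "E \<subseteq> cube (m * n)" unfolding E_def by (rule conc_power_subset[OF D])
  have fin: "finite {w \<in> E. R w}" for R
    using finite_subset[OF E] by simp
  \<comment> \<open>Labels 0, 1, 2 stand for \<open>Q - P\<close>, \<open>P \<inter> Q\<close>,
    \<open>P - Q\<close>. Thus labels 0 and 1 together give \<open>Q\<close>, and labels 1 and 2
    give \<open>P\<close>.\<close>
  define g :: "bool list \<Rightarrow> nat" where "g w = (if w \<in> P then if w \<in> Q then 1 else 2 else 0)" for w
  \<comment> \<open>Odd blocks are run through backwards, so that the inner label stays constant
    when the path passes from one block to the next.\<close>
  define turn where "turn i j = (if even i then j else N - 1 - j)" for i j :: nat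
  define f where "f w = g (take n w) * N + turn (g (take n w)) (h (drop n w))" for w
  have mem: "w \<in> {u \<in> D. R u} \<odot> {v \<in> E. R' v} \<longleftrightarrow>
      w \<in> D \<odot> E \<and> R (take n w) \<and> R' (drop n w)" for w R R'
    using D by (subst (1 2) mem_conc[where n = n]) auto
  have turn: "turn i j < N" if "j < N" for i j
    using that by (auto simp: turn_def)
  have fdm: "f w div N = g (take n w)" "f w mod N = turn (g (take n w)) (h (drop n w))" if "w \<in> D \<odot> E" for w
  proof -
    have "turn (g (take n w)) (h (drop n w)) < N"
      using that by (intro turn h) (simp add: mem_conc[OF D])
    then show "f w div N = g (take n w)" "f w mod N = turn (g (take n w)) (h (drop n w))"
      unfolding f_def by auto
  qed
  have bound: "f w < 3 * N" if "w \<in> D \<odot> E" for w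
  proof -
    have "f w div N < 3" using fdm(1)[OF that] by (simp add: g_def)
    then show ?thesis using \<open>N > 0\<close> by (simp add: div_less_iff_less_mult mult.commute)
  qed
  have "tileable T {w \<in> D \<odot> E. f w \<in> {k, Suc k}}" if k: "Suc k < 3 * N" for k
  proof -
    define i j where "i = k div N" and "j = k mod N"
    have k_eq: "k = i * N + j" and "j < N"
      using \<open>N > 0\<close> by (auto simp: i_def j_def)
    have f_eq: "f w = a * N + b \<longleftrightarrow> g (take n w) = a \<and> turn (g (take n w)) (h (drop n w)) = b"
      if "w \<in> D \<odot> E" "b < N" for w a b
    proof -
      have "f w = a * N + b \<longleftrightarrow> f w div N = a \<and> f w mod N = b"
        using \<open>b < N\<close> by (auto simp: mult.commute[of _ N])
      then show ?thesis using fdm that by simp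
    qed
    have hE: "h (drop n w) < N" if "w \<in> D \<odot> E" for w
      using that h by (simp add: mem_conc[OF D])
    show ?thesis
    proof (cases "Suc j < N")
      case True
      have "Suc k = i * N + Suc j" by (simp add: k_eq)
      \<comment> \<open>Inside a block the first factor is fixed and the inner label moves between
        \<open>l\<close> and \<open>Suc l\<close>, in either direction.\<close>
      define l where "l = (if even i then j else N - 1 - Suc j)"
      have turn_eq: "turn i b \<in> {j, Suc j} \<longleftrightarrow> b \<in> {l, Suc l}" if "b < N" for b
        using True that by (auto simp: turn_def l_def)
      have "f w \<in> {k, Suc k} \<longleftrightarrow> g (take n w) = i \<and> h (drop n w) \<in> {l, Suc l}"
        if w: "w \<in> D \<odot> E" for w
      proof -
        have "f w \<in> {k, Suc k} \<longleftrightarrow> g (take n w) = i \<and> turn (g (take n w)) (h (drop n w)) \<in> {j, Suc j}"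
          using f_eq[OF w \<open>j < N\<close>, of i] f_eq[OF w True, of i] k_eq \<open>Suc k = _\<close> by auto
        then show ?thesis
          using turn_eq[OF hE[OF w]] by metis
      qed
      then have "{w \<in> D \<odot> E. f w \<in> {k, Suc k}} = {u \<in> D. g u = i} \<odot> {v \<in> E. h v \<in> {l, Suc l}}"
        unfolding set_eq_iff mem by blast
      moreover have "Suc l < N" using True by (auto simp: l_def)
      ultimately show ?thesis
        using tileable_conc_left[OF adj[of l], of "{u \<in> D. g u = i}" n] D by auto
    next
      case False
      then have j: "j = N - 1" using \<open>j < N\<close> by simp
      have Sk: "Suc k = Suc i * N + 0" using k_eq j \<open>N > 0\<close> by simp
      then have "Suc i < 3" using k \<open>N > 0\<close> by (cases "Suc i < 3") (auto simp: not_less dest: mult_le_mono1[of 3 _ N])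
      \<comment> \<open>At a turn the inner label rests at the end \<open>l\<close> of its range
        while the outer label changes, which leaves \<open>Q\<close> or \<open>P\<close> as the
        tileable factor.\<close>
      define l where "l = (if even i then N - 1 else 0)"
      have turn_eq: "turn i b = j \<longleftrightarrow> b = l" "turn (Suc i) b = 0 \<longleftrightarrow> b = l" if "b < N" for b
        using that j by (auto simp: turn_def l_def)
      have "f w \<in> {k, Suc k} \<longleftrightarrow> g (take n w) \<in> {i, Suc i} \<and> h (drop n w) = l"
        if w: "w \<in> D \<odot> E" for w
      proof -
        have "f w = k \<longleftrightarrow> g (take n w) = i \<and> turn i (h (drop n w)) = j"
          unfolding k_eq f_eq[OF w \<open>j < N\<close>] by auto
        moreover have "f w = Suc k \<longleftrightarrow> g (take n w) = Suc i \<and> turn (Suc i) (h (drop n w)) = 0"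
          unfolding Sk f_eq[OF w \<open>N > 0\<close>] by auto
        ultimately show ?thesis
          using turn_eq[OF hE[OF w]] by blast
      qed
      then have "{w \<in> D \<odot> E. f w \<in> {k, Suc k}} = {u \<in> D. g u \<in> {i, Suc i}} \<odot> {v \<in> E. h v = l}"
        unfolding set_eq_iff mem by blast
      moreover have "{u \<in> D. g u \<in> {i, Suc i}} = (if i = 0 then Q else P)"
        using \<open>Suc i < 3\<close> by (auto simp: g_def D_def)
      ultimately show ?thesis
        using assms fin by (auto intro!: tileable_conc_right[where n = n])
    qed
  qed
  then show ?case
    using bound unfolding N_def E_def D_def by (intro exI[of _ f]) auto
qed

end

section \<open>From signed tilings to tilings\<close>

lemma conc_mono: "S \<subseteq> S' \<Longrightarrow> U \<subseteq> U' \<Longrightarrow> S \<odot> U \<subseteq> S' \<odot> U'"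
  by (auto simp: conc_def)

context tile_family
begin

text \<open>The square grid labels \<open>K\<close>, a product of two equal powers. Above
  \<open>x\<close>, a cell is removed for each tile containing \<open>x\<close>; the signs add up to
  1, so dominoes tile the rest \<open>R x\<close>. The removed parts are products
  \<open>C i \<odot> F i\<close>, tileable because \<open>F i\<close> is a tile.\<close>

lemma tileable_power_Un:
  fixes s :: "nat \<Rightarrow> int" and F :: "nat \<Rightarrow> bool list set"
  assumes PQ: "tileable T P" "tileable T Q" "P \<subseteq> cube n" "Q \<subseteq> cube n"
    and F: "\<And>i. i < l \<Longrightarrow> s i \<in> {-1, 1} \<and> T (F i) \<and> F i \<subseteq> cube a"
    and one: "\<And>x. x \<in> cube a \<Longrightarrow> (\<Sum>i<l. if x \<in> F i then s i else 0) = 1"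
  shows "\<exists>m. tileable T (conc_power (P \<union> Q) m \<odot> cube a)"
proof -
  \<comment> \<open>This exponent makes the odd side \<open>3 ^ m\<close> of the grid long enough to
    give each of the \<open>l\<close> tiles a wire of its own, besides the extra wire and the last
    column.\<close>
  define m where "m = 2 * l + 3"
  obtain L where L: "3 ^ m = 2 * Suc L + 1" "l \<le> L"
  proof -
    have "odd (3 ^ m :: nat)" by simp
    then obtain k where k: "(3 ^ m :: nat) = 2 * k + 1" by (rule oddE)
    have "m < 3 ^ m" by (rule power_gt_expt) simp
    then show thesis using k that[of "k - 1"] by (auto simp: m_def)
  qed
  define E where "E = conc_power (P \<union> Q) m"
  define e where "e = m * n"
  have E: "E \<subseteq> cube e"
    unfolding E_def e_def using PQ by (intro conc_power_subset) auto
  obtain h where h: "\<And>w. w \<in> E \<Longrightarrow> h w < 3 ^ m"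
    and adj: "\<And>i. Suc i < 3 ^ m \<Longrightarrow> tileable T {w \<in> E. h w \<in> {i, Suc i}}"
    using ex_path_labelling[OF PQ, of m] unfolding E_def by blast
  define K where "K = E \<odot> E"
  have K: "K \<subseteq> cube (e + e)"
    unfolding K_def by (intro conc_cube_subset E)
  have fin: "finite {w \<in> E. R w}" "finite {w \<in> K. R w}" for R
    using finite_subset[OF E] finite_subset[OF K] by simp_all
  define g where "g w = (h (take e w), h (drop e w))" for w
  have mem: "w \<in> {u \<in> E. R u} \<odot> {v \<in> E. R' v} \<longleftrightarrow> w \<in> K \<and> R (take e w) \<and> R' (drop e w)" for w R R'
    using E unfolding K_def by (subst (1 2) mem_conc[where n = e]) auto
  let ?S = "{..2 * Suc L} \<times> {..2 * Suc L}"
  have gS: "g w \<in> ?S" if "w \<in> K" for w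
    using that h[of "take e w"] h[of "drop e w"] unfolding K_def L(1) by (simp add: mem_conc[OF E] g_def)
  \<comment> \<open>Along a domino one coordinate is constant and the other runs through two
    consecutive labels, so its preimage is a product with a tileable factor.\<close>
  have domino: "tileable T {w \<in> K. g w \<in> A}" if A: "domino A \<and> A \<subseteq> ?S" for A
  proof -
    obtain c r where "A = {(c, r), (Suc c, r)} \<or> A = {(c, r), (c, Suc r)}"
      using A by (auto simp: domino_def)
    then show ?thesis
    proof
      assume A_eq: "A = {(c, r), (Suc c, r)}"
      have "{w \<in> K. g w \<in> A} = {u \<in> E. h u \<in> {c, Suc c}} \<odot> {v \<in> E. h v = r}"
        unfolding set_eq_iff mem by (auto simp: A_eq g_def)
      moreover have "tileable T {u \<in> E. h u \<in> {c, Suc c}}"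
        using A by (intro adj) (auto simp: A_eq L)
      ultimately show ?thesis
        using tileable_conc_right[of "{u \<in> E. h u \<in> {c, Suc c}}" e "{v \<in> E. h v = r}"] E fin by auto
    next
      assume A_eq: "A = {(c, r), (c, Suc r)}"
      have "{w \<in> K. g w \<in> A} = {u \<in> E. h u = c} \<odot> {v \<in> E. h v \<in> {r, Suc r}}"
        unfolding set_eq_iff mem by (auto simp: A_eq g_def)
      moreover have "tileable T {u \<in> E. h u \<in> {r, Suc r}}"
        using A by (intro adj) (auto simp: A_eq L)
      ultimately show ?thesis
        using tileable_conc_left[of "{v \<in> E. h v \<in> {r, Suc r}}" "{u \<in> E. h u = c}" e] E by auto
    qed
  qed
  define \<sigma> where "\<sigma> x i = (if i < l \<and> x \<in> F i then s i else 0)" for x i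
  have \<sigma>: "\<sigma> x i \<in> {-1, 0, 1}" for x i
    using F[of i] by (auto simp: \<sigma>_def)
  have sum\<sigma>: "(\<Sum>i<L. \<sigma> x i) = 1" if "x \<in> cube a" for x
  proof -
    have "(\<Sum>i<L. \<sigma> x i) = (\<Sum>i<l. if x \<in> F i then s i else 0)"
      using L(2) by (intro sum.mono_neutral_cong_right) (auto simp: \<sigma>_def)
    then show ?thesis using one[OF that] by simp
  qed
  define R where "R x = {w \<in> K. g w \<in> ?S - (\<Union>i<L. token (\<sigma> x) 0 i)}" for x
  have R: "tileable T (R x)" if "x \<in> cube a" for x
    unfolding R_def using tileable_square_minus_tokens[of "\<sigma> x" L] sum\<sigma>[OF that] \<sigma>
    by (intro tileable_vimage[OF tileable_restrict domino]) auto
  \<comment> \<open>The token of wire \<open>i\<close> is the same cell for every \<open>x\<close>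
    in \<open>F i\<close>, so the points removed on its account form a product.\<close>
  define C where "C i = {w \<in> K. g w \<in> token s 0 i}" for i
  have sub: "R x \<subseteq> cube (e + e)" "C i \<subseteq> cube (e + e)" for x i
    using K by (auto simp: R_def C_def)
  have token_\<sigma>: "token (\<sigma> x) 0 i = (if i < l \<and> x \<in> F i then token s 0 i else {})" for x i
    by (simp add: token_def \<sigma>_def)
  have "tileable T ((\<Union>i<l. C i \<odot> F i) \<union> (\<Union>x\<in>cube a. R x \<odot> {x}))"
  proof (rule tileable_Un)
    show "tileable T (\<Union>i<l. C i \<odot> F i)"
    proof (rule tileable_UN)
      show "tileable T (C i \<odot> F i)" if "i \<in> {..<l}" for i
        using that F sub(2) by (intro tileable_conc_left[where n = "e + e"] tileable_tile[where T = T]) auto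
      have "C i \<inter> C j = {}" if "i \<noteq> j" for i j
        using disjoint_token[of s 0 UNIV] that by (auto simp: C_def disjoint_family_on_def)
      then show "disjoint_family_on (\<lambda>i. C i \<odot> F i) {..<l}"
        by (fastforce simp: disjoint_family_on_def mem_conc[OF sub(2)])
    qed simp
    show "tileable T (\<Union>x\<in>cube a. R x \<odot> {x})"
    proof (rule tileable_UN)
      show "tileable T (R x \<odot> {x})" if "x \<in> cube a" for x
        using that sub(1) by (intro tileable_conc_right[where n = "e + e"] R) auto
      show "disjoint_family_on (\<lambda>x. R x \<odot> {x}) (cube a)"
        by (auto simp: disjoint_family_on_def mem_conc[OF sub(1)])
    qed simp
    have "C i \<inter> R x = {}" if "i < l" "x \<in> F i" for i x
    proof -
      have "token s 0 i \<subseteq> (\<Union>i<L. token (\<sigma> x) 0 i)"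
        using that L(2) token_\<sigma>[of x i] by (intro SUP_upper2[of i]) auto
      then show ?thesis unfolding C_def R_def by blast
    qed
    then have "\<not> (w \<in> C i \<odot> F i \<and> w \<in> R x \<odot> {x})" if "i < l" for i x w
      unfolding mem_conc[OF sub(1)] mem_conc[OF sub(2)] using that by auto
    then show "(\<Union>i<l. C i \<odot> F i) \<inter> (\<Union>x\<in>cube a. R x \<odot> {x}) = {}"
      by blast
  qed
  also have "(\<Union>i<l. C i \<odot> F i) \<union> (\<Union>x\<in>cube a. R x \<odot> {x}) = K \<odot> cube a"
  proof (intro equalityI subsetI)
    have "C i \<odot> F i \<subseteq> K \<odot> cube a" if "i < l" for i
      using F[OF that] by (intro conc_mono) (auto simp: C_def)
    moreover have "R x \<odot> {x} \<subseteq> K \<odot> cube a" if "x \<in> cube a" for x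
      using that by (intro conc_mono) (auto simp: R_def)
    ultimately show "w \<in> K \<odot> cube a"
      if "w \<in> (\<Union>i<l. C i \<odot> F i) \<union> (\<Union>x\<in>cube a. R x \<odot> {x})" for w
      using that by blast
  next
    fix w assume w: "w \<in> K \<odot> cube a"
    define y x where "y = take (e + e) w" and "x = drop (e + e) w"
    have yx: "y \<in> K" "x \<in> cube a"
      using w by (auto simp: mem_conc[OF K] y_def x_def)
    show "w \<in> (\<Union>i<l. C i \<odot> F i) \<union> (\<Union>x\<in>cube a. R x \<odot> {x})"
    proof (cases "y \<in> R x")
      case True
      then have "w \<in> R x \<odot> {x}"
        by (simp add: mem_conc[OF sub(1)] y_def x_def)
      then show ?thesis using yx by blast
    next
      case False
      then obtain i where "g y \<in> token (\<sigma> x) 0 i"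
        using gS[OF yx(1)] yx(1) unfolding R_def by blast
      then have "i < l" "x \<in> F i" "y \<in> C i"
        using yx(1) by (auto simp: token_\<sigma> C_def split: if_splits)
      then have "w \<in> C i \<odot> F i"
        by (simp add: mem_conc[OF sub(2)] y_def x_def)
      then show ?thesis using \<open>i < l\<close> by blast
    qed
  qed
  also have "K = conc_power (P \<union> Q) (m + m)"
    by (simp add: K_def E_def conc_power_add)
  finally show ?thesis by blast
qed

end

text \<open>The factor \<open>cube a\<close> introduced by the preceding lemma is why blocks of both kinds are needed in
  the induction over \<open>B\<close>.\<close>

primrec box :: "nat \<Rightarrow> bool list set \<Rightarrow> bool list \<Rightarrow> bool list set" where
  "box a B [] = {[]}"
| "box a B (b # bs) = (if b then B else cube a) \<odot> box a B bs"

lemma box_subset: "B \<subseteq> cube a \<Longrightarrow> box a B bs \<subseteq> cube (length bs * a)"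
proof (induction bs)
  case Nil
  then show ?case by (simp add: cube_def)
next
  case (Cons b bs)
  then have "(if b then B else cube a) \<odot> box a B bs \<subseteq> cube (a + length bs * a)"
    by (intro conc_cube_subset) auto
  then show ?case by simp
qed

lemma box_append: "box a B (bs @ cs) = box a B bs \<odot> box a B cs"
  by (induction bs) (auto simp: conc_assoc)

lemma conc_power_box: "conc_power (box a B bs) m = box a B (concat (replicate m bs))"
  by (induction m) (auto simp: box_append)

lemma box_mono: "B \<subseteq> B' \<Longrightarrow> box a B bs \<subseteq> box a B' bs"
proof (induction bs)
  case (Cons b bs)
  then show ?case unfolding box.simps by (intro conc_mono) auto
qed simp

lemma box_cube: "box a (cube a) bs = cube (length bs * a)"
proof (induction bs)
  case Nil
  show ?case by (auto simp: cube_def)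
qed (simp add: conc_cube_cube)

section \<open>Enlarging the covered part of the cube tile by tile\<close>

context tile_family
begin

text \<open>The words of the difference are sorted by the first block of kind \<open>B\<close> whose
  entry lies in \<open>G\<close>. That block contributes the tile \<open>G\<close> as a factor, and
  the other factors are arbitrary.\<close>

lemma tileable_box_diff:
  assumes "T G" "G \<subseteq> B" "B \<subseteq> cube a"
  shows "tileable T (box a B bs - box a (B - G) bs)"
proof (induction bs)
  case Nil
  show ?case by (simp add: tileable_empty)
next
  case (Cons b bs)
  let ?U = "box a B bs" and ?V = "box a (B - G) bs"
  have U: "?U \<subseteq> cube (length bs * a)" using assms by (intro box_subset)
  then have finU: "finite ?U" by (rule finite_subset) simp
  have G: "G \<subseteq> cube a" "B - G \<subseteq> cube a" using assms by auto
  show ?case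
  proof (cases b)
    case True
    have "tileable T (G \<odot> ?U)"
      using assms G finU by (intro tileable_conc_right tileable_tile[where T = T])
    moreover have "tileable T ((B - G) \<odot> (?U - ?V))"
      using Cons G by (intro tileable_conc_left)
    moreover have "(G \<odot> ?U) \<inter> ((B - G) \<odot> (?U - ?V)) = {}"
      by (auto simp: mem_conc[OF G(1)] mem_conc[OF G(2)])
    ultimately have "tileable T ((G \<odot> ?U) \<union> ((B - G) \<odot> (?U - ?V)))"
      by (rule tileable_Un)
    moreover have "box a B (b # bs) - box a (B - G) (b # bs) = (G \<odot> ?U) \<union> ((B - G) \<odot> (?U - ?V))"
      using True assms(2) by (auto simp: mem_conc[OF G(1)] mem_conc[OF G(2)] mem_conc[OF assms(3)])
    ultimately show ?thesis by simp
  next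
    case False
    have "box a B (b # bs) - box a (B - G) (b # bs) = cube a \<odot> (?U - ?V)"
      using False by (auto simp: mem_conc[OF order_refl])
    then show ?thesis
      using tileable_conc_left[OF Cons, of "cube a" a] by simp
  qed
qed

text \<open>Induction on the number \<open>k\<close> of tiles whose union serves as \<open>B\<close>
  in a tileable box. At the end the union is the whole cube, and so the box is a cube.\<close>

lemma tileable_cube_of_signed_tiling:
  fixes s :: "nat \<Rightarrow> int" and F :: "nat \<Rightarrow> bool list set"
  assumes F: "\<And>i. i < l \<Longrightarrow> s i \<in> {-1, 1} \<and> T (F i) \<and> F i \<subseteq> cube a"
    and one: "\<And>x. x \<in> cube a \<Longrightarrow> (\<Sum>i<l. if x \<in> F i then s i else 0) = 1"
  shows "\<exists>n>0. tileable T (cube n)"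
proof -
  have "\<exists>bs. tileable T (box a (\<Union>i<k. F i) bs)" if "k \<le> l" for k
    using that
  proof (induction k)
    \<comment> \<open>The union of no tiles is empty, so a single block of this kind makes the box
      empty.\<close>
    case 0
    show ?case by (intro exI[of _ "[True]"]) (simp add: tileable_empty)
  next
    case (Suc k)
    define B G where "B = (\<Union>i<k. F i)" and "G = F k"
    have sub: "B \<subseteq> cube a" "G \<subseteq> cube a" "T G"
    proof -
      have "F i \<subseteq> cube a \<and> T (F i)" if "i \<le> k" for i
        using F[of i] Suc.prems that by simp
      then show "B \<subseteq> cube a" "G \<subseteq> cube a" "T G"
        by (simp_all add: B_def G_def UN_subset_iff)
    qed
    obtain bs where bs: "tileable T (box a B bs)"
      using Suc by (auto simp: B_def)
    let ?D = "box a (B \<union> G) bs"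
    have G: "tileable T (?D - box a (B \<union> G - G) bs)"
      using sub by (intro tileable_box_diff) auto
    \<comment> \<open>The new tile may overlap \<open>B\<close>. Hence the two tileable parts cover
      \<open>?D\<close> but need not be disjoint, and a power of \<open>?D\<close> is used in place
      of \<open>?D\<close>.\<close>
    have "box a (B \<union> G - G) bs \<subseteq> box a B bs" "box a B bs \<subseteq> ?D"
      by (intro box_mono; blast)+
    then have D: "?D = box a B bs \<union> (?D - box a (B \<union> G - G) bs)"
      by blast
    have "?D \<subseteq> cube (length bs * a)"
      using sub by (intro box_subset) auto
    then obtain m where "tileable T (conc_power ?D m \<odot> cube a)"
      using tileable_power_Un[OF bs G _ _ F one] D by (metis Un_subset_iff)
    moreover have "conc_power ?D m \<odot> cube a = box a (B \<union> G) (concat (replicate m bs) @ [False])"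
      by (simp add: box_append conc_power_box)
    moreover have "(\<Union>i<Suc k. F i) = B \<union> G"
      by (auto simp: B_def G_def lessThan_Suc)
    ultimately show ?case by metis
  qed
  then obtain bs where bs: "tileable T (box a (\<Union>i<l. F i) bs)"
    by blast
  have "x \<in> (\<Union>i<l. F i)" if "x \<in> cube a" for x
  proof (rule ccontr)
    assume "x \<notin> (\<Union>i<l. F i)"
    then have "(\<Sum>i<l. if x \<in> F i then s i else 0) = 0"
      by (intro sum.neutral) auto
    then show False using one[OF that] by simp
  qed
  then have "(\<Union>i<l. F i) = cube a"
    using F by blast
  then have "tileable T (cube (length bs * a))"
    using bs by (simp add: box_cube)
  \<comment> \<open>The extra coordinate makes the dimension positive even if
    \<open>length bs * a\<close> is 0.\<close>
  then have "tileable T (cube (length bs * a) \<odot> cube 1)"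
    by (intro tileable_conc_right[where n = "length bs * a"]) auto
  then show ?thesis
    by (auto simp: conc_cube_cube)
qed

end

section \<open>Signed tilings of cubes\<close>

text \<open>These are the functions that vanish in the quotient by the copies. They matter only on
  \<open>cube a\<close>, so equalities are demanded there alone; integer coefficients arise by
  repeating a tile.\<close>

inductive signed_sum :: "(bool list set \<Rightarrow> bool) \<Rightarrow> nat \<Rightarrow> (bool list \<Rightarrow> int) \<Rightarrow> bool" for T a where
  signed_sum_zero: "(\<And>x. x \<in> cube a \<Longrightarrow> f x = 0) \<Longrightarrow> signed_sum T a f"
| signed_sum_step: "signed_sum T a f \<Longrightarrow> T F \<Longrightarrow> F \<subseteq> cube a \<Longrightarrow> s \<in> {-1, 1} \<Longrightarrow>
    (\<And>x. x \<in> cube a \<Longrightarrow> g x = f x + (if x \<in> F then s else 0)) \<Longrightarrow> signed_sum T a g"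

lemma signed_sum_cong:
  assumes "signed_sum T a f" "\<And>x. x \<in> cube a \<Longrightarrow> g x = f x"
  shows "signed_sum T a g"
  using assms(1)
proof cases
  case signed_sum_zero
  then show ?thesis using assms(2) by (intro signed_sum.signed_sum_zero) simp
next
  case (signed_sum_step f' F s)
  then show ?thesis using assms(2) by (intro signed_sum.signed_sum_step[of T a f' F s g]) auto
qed

lemma signed_sum_indexed:
  assumes "signed_sum T a f"
  shows "\<exists>l s F. (\<forall>i<l. s i \<in> {-1, 1} \<and> T (F i) \<and> F i \<subseteq> cube a) \<and>
    (\<forall>x\<in>cube a. (\<Sum>i<(l::nat). if x \<in> F i then s i else 0) = f x)"
  using assms
proof induction
  case (signed_sum_zero f)
  then show ?case by (intro exI[of _ 0]) auto
next
  case (signed_sum_step f G t g)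
  then obtain l s F where *: "\<forall>i<l. s i \<in> {-1, 1} \<and> T (F i) \<and> F i \<subseteq> cube a"
    "\<forall>x\<in>cube a. (\<Sum>i<(l::nat). if x \<in> F i then s i else 0) = f x"
    by blast
  have "(\<Sum>i<l. if x \<in> (F(l := G)) i then (s(l := t)) i else 0) = (\<Sum>i<l. if x \<in> F i then s i else 0)" for x
    by (intro sum.cong) auto
  then show ?case
    using * signed_sum_step
    by (intro exI[of _ "Suc l"] exI[of _ "s(l := t)"] exI[of _ "F(l := G)"]) (auto simp: less_Suc_eq)
qed

lemma signed_sum_add:
  assumes "signed_sum T a f" "signed_sum T a g"
  shows "signed_sum T a (\<lambda>x. f x + g x)"
  using assms(1)
proof induction
  case (signed_sum_zero f)
  then show ?case by (intro signed_sum_cong[OF assms(2)]) simp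
next
  case (signed_sum_step f F s f')
  show ?case
    by (rule signed_sum.signed_sum_step[OF signed_sum_step.IH signed_sum_step(2-4)])
      (simp add: signed_sum_step)
qed

lemma signed_sum_uminus:
  assumes "signed_sum T a f"
  shows "signed_sum T a (\<lambda>x. - f x)"
  using assms
proof induction
  case (signed_sum_zero f)
  then show ?case by (intro signed_sum.signed_sum_zero) simp
next
  case (signed_sum_step f F s f')
  show ?case
    by (rule signed_sum.signed_sum_step[OF signed_sum_step.IH signed_sum_step(2,3), of "- s"])
      (use signed_sum_step(4) in \<open>auto simp: signed_sum_step(5)\<close>)
qed

lemma signed_sum_tile:
  assumes "T F" "F \<subseteq> cube a"
  shows "signed_sum T a (\<lambda>x. of_bool (x \<in> F))"
proof (rule signed_sum_step[of T a "\<lambda>_. 0" F 1])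
  show "signed_sum T a (\<lambda>_. 0)" by (rule signed_sum_zero) simp
qed (use assms in auto)

lemma signed_sum_scale:
  assumes "signed_sum T a f"
  shows "signed_sum T a (\<lambda>x. c * f x)"
proof -
  have nat: "signed_sum T a (\<lambda>x. int n * f x)" for n
  proof (induction n)
    case 0
    show ?case by (intro signed_sum_zero) simp
  next
    case (Suc n)
    show ?case
      by (rule signed_sum_cong[OF signed_sum_add[OF Suc assms]]) (simp add: algebra_simps)
  qed
  show ?thesis
  proof (cases "c \<ge> 0")
    case True
    then show ?thesis using nat[of "nat c"] by simp
  next
    case False
    then show ?thesis using signed_sum_uminus[OF nat[of "nat (- c)"]] by simp
  qed
qed

lemma signed_sum_sum:
  assumes "finite I" "\<And>i. i \<in> I \<Longrightarrow> signed_sum T a (f i)"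
  shows "signed_sum T a (\<lambda>x. \<Sum>i\<in>I. f i x)"
  using assms
proof (induction I)
  case empty
  show ?case by (rule signed_sum_zero) simp
next
  case (insert i I)
  then have "signed_sum T a (\<lambda>x. f i x + (\<Sum>i\<in>I. f i x))"
    by (intro signed_sum_add) simp_all
  then show ?case using insert.hyps by simp
qed

section \<open>Tensor products of signed sums with arbitrary functions\<close>

context tile_family
begin

lemma signed_sum_frame:
  assumes "signed_sum T b f" "u \<in> cube a" "v \<in> cube c"
  shows "signed_sum T (a + b + c)
    (\<lambda>w. if take a w = u \<and> drop (a + b) w = v then f (take b (drop a w)) else 0)"
  using assms(1)
proof induction
  case (signed_sum_zero f)
  have "take b (drop a w) \<in> cube b" if "w \<in> cube (a + b + c)" for w
    using that by (simp add: cube_def)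
  then show ?case using signed_sum_zero by (intro signed_sum.signed_sum_zero) simp
next
  case (signed_sum_step f F s g)
  let ?G = "(\<lambda>x. u @ x @ v) ` F"
  have lens: "length u = a" "length v = c" "\<And>x. x \<in> F \<Longrightarrow> length x = b"
    using assms signed_sum_step(3) by (auto simp: cube_def)
  have mem: "w \<in> ?G \<longleftrightarrow> take a w = u \<and> drop (a + b) w = v \<and> take b (drop a w) \<in> F"
    if "w \<in> cube (a + b + c)" for w
  proof
    assume "w \<in> ?G"
    then show "take a w = u \<and> drop (a + b) w = v \<and> take b (drop a w) \<in> F"
      using lens by auto
  next
    assume w: "take a w = u \<and> drop (a + b) w = v \<and> take b (drop a w) \<in> F"
    then have "w = u @ take b (drop a w) @ v"
      by (metis append_take_drop_id drop_drop add.commute)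
    then show "w \<in> ?G" using w by blast
  qed
  have cube: "take b (drop a w) \<in> cube b" if "w \<in> cube (a + b + c)" for w
    using that by (simp add: cube_def)
  show ?case
  proof (rule signed_sum.signed_sum_step[OF signed_sum_step.IH])
    show "T ?G" using frame signed_sum_step by blast
    show "?G \<subseteq> cube (a + b + c)" using lens by (auto simp: cube_def)
    show "s \<in> {-1, 1}" by fact
  next
    fix w assume w: "w \<in> cube (a + b + c)"
    show "(if take a w = u \<and> drop (a + b) w = v then g (take b (drop a w)) else 0) =
      (if take a w = u \<and> drop (a + b) w = v then f (take b (drop a w)) else 0) + (if w \<in> ?G then s else 0)"
      unfolding mem[OF w] using signed_sum_step.hyps(5)[OF cube[OF w]] by auto
  qed
qed

text \<open>The function \<open>g\<close> is an integer combination of point masses, and multiplying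
  \<open>f\<close> by a point mass at \<open>u\<close> amounts to placing its tiles in the face with
  prefix \<open>u\<close>.\<close>

lemma signed_sum_times_left:
  assumes "signed_sum T b f"
  shows "signed_sum T (a + b) (\<lambda>w. g (take a w) * f (drop a w))"
proof -
  let ?h = "\<lambda>w. \<Sum>u\<in>cube a. g u *
    (if take a w = u \<and> drop (a + b) w = [] then f (take b (drop a w)) else 0)"
  have "signed_sum T (a + b + 0) ?h"
    by (intro signed_sum_sum signed_sum_scale signed_sum_frame assms finite_cube) (simp_all add: cube_def)
  then have "signed_sum T (a + b) ?h" by (simp only: add_0_right)
  then show ?thesis
  proof (rule signed_sum_cong)
    fix w assume "w \<in> cube (a + b)"
    then have "take a w \<in> cube a" "take b (drop a w) = drop a w" "drop (a + b) w = []"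
      by (auto simp: cube_def)
    then show "g (take a w) * f (drop a w) = ?h w"
      by (simp add: if_distrib[of "\<lambda>t. _ * t"] sum.delta cong: if_cong)
  qed
qed

lemma signed_sum_times_right:
  assumes "signed_sum T b f"
  shows "signed_sum T (b + c) (\<lambda>w. f (take b w) * g (drop b w))"
proof -
  let ?h = "\<lambda>w. \<Sum>v\<in>cube c. g v *
    (if take 0 w = [] \<and> drop (0 + b) w = v then f (take b (drop 0 w)) else 0)"
  have "signed_sum T (0 + b + c) ?h"
    by (intro signed_sum_sum signed_sum_scale signed_sum_frame assms finite_cube) (simp_all add: cube_def)
  then have "signed_sum T (b + c) ?h" by (simp only: add_0_left)
  then show ?thesis
  proof (rule signed_sum_cong)
    fix w assume "w \<in> cube (b + c)"
    then have "drop b w \<in> cube c"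
      by (auto simp: cube_def)
    then show "f (take b w) * g (drop b w) = ?h w"
      by (simp add: if_distrib[of "\<lambda>t. _ * t"] sum.delta cong: if_cong)
  qed
qed

end

text \<open>Inequality of Booleans is addition modulo 2, so this is addition in the group of bit
  vectors.\<close>

definition translate :: "bool list \<Rightarrow> bool list \<Rightarrow> bool list" where
  "translate t x = map2 (\<noteq>) t x"

lemma translate_in_cube [simp]: "t \<in> cube a \<Longrightarrow> x \<in> cube a \<Longrightarrow> translate t x \<in> cube a"
  by (simp add: cube_def translate_def)

lemma translate_translate [simp]: "t \<in> cube a \<Longrightarrow> x \<in> cube a \<Longrightarrow> translate t (translate t x) = x"
  by (intro nth_equalityI) (auto simp: cube_def translate_def)

lemma translate_commute: "translate t x = translate x t"
  by (auto simp: translate_def zip_commute[of x t])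

lemma mem_translate_image:
  assumes "F \<subseteq> cube a" "t \<in> cube a" "x \<in> cube a"
  shows "x \<in> translate t ` F \<longleftrightarrow> translate t x \<in> F"
proof
  assume "x \<in> translate t ` F"
  then show "translate t x \<in> F" using assms by auto
next
  assume "translate t x \<in> F"
  then show "x \<in> translate t ` F"
    using assms translate_translate[of t a x] by (metis imageI)
qed

section \<open>Translation-invariant families and parity\<close>

locale invariant_tile_family = tile_family +
  assumes translate: "T F \<Longrightarrow> F \<subseteq> cube a \<Longrightarrow> t \<in> cube a \<Longrightarrow> T (translate t ` F)"
begin

lemma signed_sum_translate:
  assumes "signed_sum T a f" "t \<in> cube a"
  shows "signed_sum T a (\<lambda>x. f (translate t x))"
  using assms(1)
proof induction
  case (signed_sum_zero f)
  then show ?case using assms(2) by (intro signed_sum.signed_sum_zero) simp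
next
  case (signed_sum_step f F s g)
  show ?case
  proof (rule signed_sum.signed_sum_step[OF signed_sum_step.IH])
    show "T (translate t ` F)" "translate t ` F \<subseteq> cube a"
      using signed_sum_step translate assms(2) by auto
    show "s \<in> {-1, 1}" by fact
  next
    fix x assume "x \<in> cube a"
    then show "g (translate t x) = f (translate t x) + (if x \<in> translate t ` F then s else 0)"
      using signed_sum_step assms(2) by (simp add: mem_translate_image)
  qed
qed

text \<open>In the sum of all translates of \<open>F\<close>, a point \<open>x\<close> is counted
  once for each \<open>t\<close> that takes it into \<open>F\<close>, and these \<open>t\<close>
  correspond to the elements of \<open>F\<close>.\<close>

lemma signed_sum_card:
  assumes "T F" "F \<subseteq> cube a"
  shows "signed_sum T a (\<lambda>_. int (card F))"
proof (rule signed_sum_cong)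
  show "signed_sum T a (\<lambda>x. \<Sum>t\<in>cube a. of_bool (translate t x \<in> F))"
    using signed_sum_translate[OF signed_sum_tile[of T, OF assms]] by (intro signed_sum_sum) auto
  show "int (card F) = (\<Sum>t\<in>cube a. of_bool (translate t x \<in> F))" if x: "x \<in> cube a" for x
  proof -
    have "bij_betw (translate x) {t \<in> cube a. translate t x \<in> F} F"
      using assms(2) x
      by (intro bij_betw_byWitness[where f' = "translate x"]) (auto simp: translate_commute[of _ x])
    then have "card {t \<in> cube a. translate t x \<in> F} = card F"
      by (rule bij_betw_same_card)
    moreover have "(\<Sum>t\<in>cube a. of_bool (translate t x \<in> F)) = int (card {t \<in> cube a. translate t x \<in> F})"
      by (simp add: of_bool_def sum.If_cases Int_def)
    ultimately show ?thesis by simp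
  qed
qed

text \<open>Modulo 2, adding to a function its translate by a unit vector makes it invariant under
  that translation, and it is already invariant if the sum vanishes.\<close>

lemma signed_sum_odd:
  assumes "signed_sum T a f" "x \<in> cube a" "odd (f x)"
  shows "\<exists>g. signed_sum T a g \<and> (\<forall>x\<in>cube a. odd (g x))"
proof -
  define flip :: "nat \<Rightarrow> bool list \<Rightarrow> bool list" where "flip i x = x[i := \<not> x ! i]" for i x
  have flip_cube: "flip i x \<in> cube a \<longleftrightarrow> x \<in> cube a" for i x
    by (simp add: flip_def cube_def)
  have flip_flip: "flip i (flip i x) = x" if "i < a" "x \<in> cube a" for i x
    using that by (simp add: flip_def cube_def)
  have flip_commute: "flip i (flip j x) = flip j (flip i x)" for i j x
    by (cases "i = j") (simp_all add: flip_def list_update_swap)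
  have flip: "signed_sum T a (\<lambda>x. g (flip i x))" if g: "signed_sum T a g" "i < a" for g i
  proof (rule signed_sum_cong)
    let ?t = "map (\<lambda>j. j = i) [0..<a]"
    show "signed_sum T a (\<lambda>x. g (translate ?t x))"
      using g by (intro signed_sum_translate) (simp_all add: cube_def)
    show "g (flip i x) = g (translate ?t x)" if "x \<in> cube a" for x
    proof -
      have "flip i x = translate ?t x"
        using that g(2) by (intro nth_equalityI) (auto simp: flip_def translate_def cube_def nth_list_update)
      then show ?thesis by simp
    qed
  qed
  \<comment> \<open>Invariance modulo 2 is gained one coordinate at a time, while an odd value
    somewhere is retained.\<close>
  have "\<exists>g. signed_sum T a g \<and> (\<exists>x\<in>cube a. odd (g x)) \<and>
      (\<forall>i<j. \<forall>x\<in>cube a. even (g (flip i x) - g x))" if "j \<le> a" for j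
    using that
  proof (induction j)
    case 0
    then show ?case using assms by auto
  next
    case (Suc j)
    then obtain g where g: "signed_sum T a g" "\<exists>x\<in>cube a. odd (g x)"
      and inv: "\<And>i x. i < j \<Longrightarrow> x \<in> cube a \<Longrightarrow> even (g (flip i x) - g x)"
      using Suc_leD by blast
    show ?case
    proof (cases "\<exists>x\<in>cube a. odd (g (flip j x) + g x)")
      case True
      have "even ((g (flip j (flip i x)) + g (flip i x)) - (g (flip j x) + g x))"
        if "i < Suc j" "x \<in> cube a" for i x
      proof (cases "i = j")
        case True
        then show ?thesis using that Suc.prems by (simp add: flip_flip)
      next
        case False
        then have "even (g (flip i (flip j x)) - g (flip j x))" "even (g (flip i x) - g x)"
          using that by (simp_all only: inv flip_cube less_Suc_eq simp_thms)
        then show ?thesis by (simp add: flip_commute[of j i])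
      qed
      then show ?thesis
        using True signed_sum_add[OF flip[OF g(1), of j] g(1)] Suc.prems
        by (intro exI[of _ "\<lambda>x. g (flip j x) + g x"]) auto
    next
      case False
      then show ?thesis using g inv by (intro exI[of _ g]) (auto simp: less_Suc_eq)
    qed
  qed
  then obtain g z where g: "signed_sum T a g" "z \<in> cube a" "odd (g z)"
    and inv: "\<And>i x. i < a \<Longrightarrow> x \<in> cube a \<Longrightarrow> even (g (flip i x) - g x)"
    by blast
  have "odd (g w)" if w: "w \<in> cube a" for w
  proof -
    \<comment> \<open>Passing from \<open>z\<close> to \<open>w\<close> coordinate by coordinate,
      each step changes nothing or is a flip, so the parity of \<open>g\<close> persists.\<close>
    have "odd (g (take j w @ drop j z))" if "j \<le> a" for j
      using that
    proof (induction j)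
      case 0
      then show ?case using g by simp
    next
      case (Suc j)
      let ?u = "take j w @ drop j z" and ?v = "take (Suc j) w @ drop (Suc j) z"
      have len: "length w = a" "length z = a" using w g by (simp_all add: cube_def)
      have drop: "drop j z = z ! j # drop (Suc j) z"
        using Suc.prems len by (simp add: Cons_nth_drop_Suc)
      have take: "take (Suc j) w = take j w @ [w ! j]"
        using Suc.prems len by (simp add: take_Suc_conv_app_nth)
      have "?v = ?u \<or> ?v = flip j ?u"
        unfolding drop take flip_def using Suc.prems len
        by (cases "w ! j = z ! j") (auto simp: list_update_append nth_append)
      moreover have "?u \<in> cube a"
        using len Suc.prems by (simp add: cube_def)
      ultimately show ?case
        using Suc inv[of j ?u] by (auto)
    qed
    from this[of a] w show ?thesis using g(2) by (simp add: cube_def)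
  qed
  then show ?thesis using g by blast
qed

text \<open>With an everywhere odd signed sum \<open>f = 2 * h + 1\<close>, the constant
  \<open>2 ^ c\<close> equals \<open>2 ^ c * f - 2 ^ Suc c * h\<close>. Both terms are signed sums
  once \<open>2 ^ Suc c\<close> is one, with \<open>f\<close> and \<open>h\<close> living on
  \<open>k\<close> new coordinates. So the constant \<open>card X = 2 ^ m\<close> can be halved
  \<open>m\<close> times.\<close>

lemma signed_sum_one:
  assumes "T X" "X \<subseteq> cube k" "card X = 2 ^ m"
  shows "\<exists>n. signed_sum T n (\<lambda>_. 1)"
proof -
  have "X \<noteq> {}" using assms(3) by auto
  then obtain x where "x \<in> X" by blast
  then obtain f where f: "signed_sum T k f" "\<And>x. x \<in> cube k \<Longrightarrow> odd (f x)"
    using signed_sum_odd[OF signed_sum_tile[of T, OF assms(1,2)], of x] assms(2) by auto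
  define h where "h x = (f x - 1) div 2" for x
  have h: "f x = 2 * h x + 1" if "x \<in> cube k" for x
    using f(2)[OF that] by (simp add: h_def)
  have "\<exists>n. signed_sum T n (\<lambda>_. 2 ^ (m - i))" if "i \<le> m" for i
    using that
  proof (induction i)
    case 0
    show ?case using signed_sum_card[OF assms(1,2)] assms(3) by auto
  next
    case (Suc i)
    then obtain n where n: "signed_sum T n (\<lambda>_. 2 ^ (m - i))" by auto
    define c where "c = m - Suc i"
    have c: "m - i = Suc c" using Suc.prems by (simp add: c_def)
    have "signed_sum T (n + k) (\<lambda>w. 2 ^ c * f (drop n w) + - (2 ^ Suc c * h (drop n w)))"
      using signed_sum_times_left[OF f(1), of n "\<lambda>_. 2 ^ c"]
        signed_sum_times_right[OF n, of k h] unfolding c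
      by (intro signed_sum_add signed_sum_uminus)
    then have "signed_sum T (n + k) (\<lambda>_. 2 ^ c)"
    proof (rule signed_sum_cong)
      show "2 ^ c = 2 ^ c * f (drop n w) + - (2 ^ Suc c * h (drop n w))" if "w \<in> cube (n + k)" for w
        using that by (subst h) (auto simp: cube_def algebra_simps)
    qed
    then show ?case unfolding c_def by blast
  qed
  from this[of m] show ?thesis by simp
qed

end

section \<open>Isometric copies\<close>

lemma hamming_dist_append:
  assumes "length x = length y"
  shows "hamming_dist (u @ x @ v) (u @ y @ v) = hamming_dist x y"
proof -
  \<comment> \<open>Counting along the zipped list makes the distance additive under
    concatenation.\<close>
  have count: "hamming_dist x y = length (filter (\<lambda>(b, c). b \<noteq> c) (zip x y))"
    if "length x = length y" for x y :: "bool list"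
    using that unfolding hamming_dist_def length_filter_conv_card
    by (intro arg_cong[of _ _ card]) auto
  have same: "filter (\<lambda>(b, c). b \<noteq> c) (zip w w) = []" for w :: "bool list"
    by (induction w) auto
  show ?thesis
    using assms same by (simp add: count)
qed

lemma hamming_dist_translate:
  assumes "t \<in> cube n" "x \<in> cube n" "y \<in> cube n"
  shows "hamming_dist (translate t x) (translate t y) = hamming_dist x y"
  unfolding hamming_dist_def using assms
  by (intro arg_cong[of _ _ card]) (auto simp: translate_def cube_def)

lemma isometric_copy_subset: "isometric_copy k X n Y \<Longrightarrow> X \<subseteq> cube k \<Longrightarrow> Y \<subseteq> cube n"
  by (auto simp: isometric_copy_def cube_isometry_def)

lemma isometric_copy_image:
  assumes "isometric_copy k X n Y" "X \<subseteq> cube k" "n \<le> n'"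
    and f: "f \<in> cube n \<rightarrow> cube n'"
      "\<And>x y. x \<in> cube n \<Longrightarrow> y \<in> cube n \<Longrightarrow> hamming_dist (f x) (f y) = hamming_dist x y"
  shows "isometric_copy k X n' (f ` Y)"
proof -
  obtain \<phi> where \<phi>: "k \<le> n" "cube_isometry k n \<phi>" "Y = \<phi> ` X"
    using assms(1) by (auto simp: isometric_copy_def)
  have "cube_isometry k n' (f \<circ> \<phi>)"
    using \<phi>(2) f unfolding cube_isometry_def by (auto simp: Pi_iff)
  then show ?thesis
    using \<phi> assms(3) by (auto simp: isometric_copy_def image_comp)
qed

lemma isometric_copy_refl: "isometric_copy k X k X"
  by (auto simp: isometric_copy_def cube_isometry_def intro!: exI[of _ id])

lemma invariant_tile_family_isometric_copies:
  assumes "X \<subseteq> cube k" "X \<noteq> {}"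
  shows "invariant_tile_family (\<lambda>Y. \<exists>n. isometric_copy k X n Y)"
proof
  fix F u v assume "\<exists>n. isometric_copy k X n F"
  then obtain n where n: "isometric_copy k X n F" by blast
  have "isometric_copy k X (length u + n + length v) ((\<lambda>s. u @ s @ v) ` F)"
    by (rule isometric_copy_image[OF n assms(1)]) (auto simp: cube_def hamming_dist_append)
  then show "\<exists>n. isometric_copy k X n ((\<lambda>s. u @ s @ v) ` F)" by blast
next
  fix F a t assume "\<exists>n. isometric_copy k X n F" and F: "F \<subseteq> cube a" and t: "t \<in> cube a"
  then obtain n where n: "isometric_copy k X n F" by blast
  have "F \<noteq> {}" using n assms(2) by (auto simp: isometric_copy_def)
  \<comment> \<open>A nonempty set of words of one length determines its dimension.\<close>
  then have "n = a"
    using isometric_copy_subset[OF n assms(1)] F by (auto simp: cube_def)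
  then have "isometric_copy k X a (translate t ` F)"
    using t by (intro isometric_copy_image[OF n assms(1)]) (auto simp: hamming_dist_translate)
  then show "\<exists>n. isometric_copy k X n (translate t ` F)" by blast
qed

text \<open>Blocks of a partition are nonempty, so an empty tile has to be excluded.\<close>

lemma tileable_partition:
  assumes "tileable T S" "\<not> T {}"
  shows "\<exists>P. partition_on S P \<and> (\<forall>Y\<in>P. T Y)"
  using assms(1)
proof induction
  case tileable_empty
  show ?case by (intro exI[of _ "{}"]) (auto simp: partition_on_def)
next
  case (tileable_insert F S)
  then obtain P where P: "partition_on S P" "\<forall>Y\<in>P. T Y" by blast
  have "F \<noteq> {}" using tileable_insert assms(2) by auto
  have "partition_on (F \<union> S) (insert F P)"
    using partition_on_insert[of F P "F \<union> S"] P \<open>F \<noteq> {}\<close> tileable_insert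
    by (auto simp: partition_on_def disjoint_def disjnt_def)
  then show ?case using P tileable_insert by blast
qed

theorem theorem2:
  fixes k :: nat and X :: "bool list set"
  assumes "k > 0"
    and "X \<subseteq> cube k"
    and "\<exists>m::nat. card X = 2 ^ m"
  shows "\<exists>n>0. \<exists>P. partition_on (cube n) P \<and> (\<forall>Y\<in>P. isometric_copy k X n Y)"
proof -
  define T where "T Y \<longleftrightarrow> (\<exists>n. isometric_copy k X n Y)" for Y
  obtain m where m: "card X = 2 ^ m" using assms(3) by blast
  then have X: "X \<noteq> {}" by auto
  interpret invariant_tile_family T
    using invariant_tile_family_isometric_copies[OF assms(2) X] unfolding T_def .
  have "T X" using isometric_copy_refl unfolding T_def by blast
  then obtain a where "signed_sum T a (\<lambda>_. 1)"
    using signed_sum_one assms(2) m by blast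
  then obtain l and s :: "nat \<Rightarrow> int" and F where "\<forall>i<l. s i \<in> {-1, 1} \<and> T (F i) \<and> F i \<subseteq> cube a"
    "\<forall>x\<in>cube a. (\<Sum>i<(l::nat). if x \<in> F i then s i else 0) = 1"
    using signed_sum_indexed by blast
  then obtain n where n: "n > 0" "tileable T (cube n)"
    using tileable_cube_of_signed_tiling[of l s F a] by blast
  have ne: "\<not> T {}" using X by (auto simp: T_def isometric_copy_def)
  obtain P where P: "partition_on (cube n) P" "\<forall>Y\<in>P. T Y"
    using tileable_partition[OF n(2) ne] by blast
  \<comment> \<open>The predicate \<open>T\<close> forgets the dimension of the target cube; it is
    recovered from the length of any word in the block.\<close>
  have "isometric_copy k X n Y" if Y: "Y \<in> P" for Y
  proof -
    obtain n' where n': "isometric_copy k X n' Y" using P(2) Y unfolding T_def by blast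
    have "Y \<noteq> {}" "Y \<subseteq> cube n" "Y \<subseteq> cube n'"
      using P(1) Y isometric_copy_subset[OF n' assms(2)] by (auto simp: partition_on_def)
    then have "n' = n" by (auto simp: cube_def)
    then show ?thesis using n' by simp
  qed
  then show ?thesis using n(1) P(1) by blast
qed

end
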